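(* For $a,b>0$, define the ellipse $\mathcal{E}(a,b):=\left\{y\in\mathbb{R}^2:\frac{y_1^2}{a^2}+\frac{y_2^2}{b^2}\le1\right\}$. Let $\Theta_S:=\mathcal{E}(a,b_S)$ and $\Theta_L:=\mathcal{E}(a,b_L)$, where $a>0$ and $0<b_S<b_L<\frac a2$. Then $\Theta_S\subsetneq\Theta_L$ and $$R_\infty(0;\Theta_S)>R_\infty(0;\Theta_L).$$
   Context: For a nonempty compact convex set $\Theta\subseteq\mathbb{R}^d$ and $u\in\mathcal{S}^{d-1}$ (the unit sphere), $F_\Theta(u)=\arg\max_{\theta\in\Theta}\langle\theta,u\rangle$ is the exposed face (set of maximizers) in direction $u$; $\Pi_K$ is the Euclidean projection onto a nonempty compact convex set $K$. For $\theta\in\Theta$, the limiting (diverging-noise) risk is $R_\infty(\theta;\Theta)=\mathbb{E}\|\Pi_{F_\Theta(U)}(\theta)-\theta\|^2$, where $U$ is uniformly distributed on $\mathcal{S}^{d-1}$ (here $d=2$). *)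

theory Defs
  imports "HOL-Probability.Probability"
begin

definition ellipse :: "real \<Rightarrow> real \<Rightarrow> (real ^ 2) set" where
  "ellipse a b = {y. (y $ 1)\<^sup>2 / a\<^sup>2 + (y $ 2)\<^sup>2 / b\<^sup>2 \<le> 1}"

definition max_face :: "'a::euclidean_space set \<Rightarrow> 'a \<Rightarrow> 'a set" where
  "max_face \<Theta> u = {\<theta>. is_arg_max (\<lambda>\<theta>. \<theta> \<bullet> u) (\<lambda>\<theta>. \<theta> \<in> \<Theta>) \<theta>}"

text \<open>The uniform distribution on the unit sphere, in every dimension: the law of \<open>X / norm X\<close>
  for \<open>X\<close> uniform in the unit ball. It is realised as a Borel measure on the ambient space; the
  value of the map at the origin is irrelevant. The lemmas below show that it is a probability
  measure carried by the sphere and invariant under orthogonal maps, which characterises the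
  uniform distribution.\<close>

definition uniform_sphere :: "'a::euclidean_space measure" where
  "uniform_sphere = distr (uniform_measure lborel (ball 0 1)) borel (\<lambda>x. x /\<^sub>R norm x)"

lemma ball_emeasure_nontrivial:
  "emeasure lborel (ball (0::'a::euclidean_space) 1) \<noteq> 0"
  "emeasure lborel (ball (0::'a::euclidean_space) 1) \<noteq> \<infinity>"
proof -
  show "emeasure lborel (ball (0::'a) 1) \<noteq> 0"
    using open_not_negligible[of "ball (0::'a) 1"]
    by (auto simp: negligible_iff_null_sets null_sets_def)
  show "emeasure lborel (ball (0::'a) 1) \<noteq> \<infinity>"
    using emeasure_lborel_ball_finite[of "0::'a" 1] by simp
qed

lemma prob_space_uniform_sphere: "prob_space (uniform_sphere :: 'a::euclidean_space measure)"
  unfolding uniform_sphere_def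
  by (intro prob_space.prob_space_distr prob_space_uniform_measure)
     (use ball_emeasure_nontrivial in auto)

lemma AE_uniform_sphere: "AE u in (uniform_sphere :: 'a::euclidean_space measure). u \<in> sphere 0 1"
proof -
  have "AE x in lborel. x \<noteq> (0::'a)"
    by (rule AE_I[where N = "{0}"]) auto
  then have "AE x in uniform_measure lborel (ball (0::'a) 1). x /\<^sub>R norm x \<in> sphere 0 1"
    by (intro AE_uniform_measureI) auto
  then show ?thesis
    unfolding uniform_sphere_def by (subst AE_distr_iff) auto
qed

lemma distr_uniform_sphere_orthogonal:
  fixes T :: "real ^ 'n::{finite,wellorder} \<Rightarrow> real ^ 'n::_"
  assumes T: "orthogonal_transformation T"
  shows "distr uniform_sphere borel T = uniform_sphere"
proof -
  let ?B = "ball 0 1 :: (real ^ 'n::_) set"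
  let ?U = "uniform_measure lborel ?B"
  have lin: "linear T" and nT: "norm (T x) = norm x" for x
    using T by (auto simp: orthogonal_transformation_linear orthogonal_transformation_norm)
  have mT[measurable]: "T \<in> borel_measurable borel"
    using lin by (intro borel_measurable_continuous_onI linear_continuous_on)
      (simp add: linear_conv_bounded_linear)
  have mn[measurable]: "(\<lambda>x::real ^ 'n::_. x /\<^sub>R norm x) \<in> borel_measurable borel"
    by measurable
  have "distr ?U borel T = ?U"
  proof (rule measure_eqI)
    fix A assume "A \<in> sets (distr ?U borel T)"
    then have A[measurable]: "A \<in> sets borel" by simp
    have TA[measurable]: "T -` A \<in> sets borel"
      using measurable_sets[OF mT A] by simp
    have im: "T ` (?B \<inter> T -` A) = ?B \<inter> A"
    proof -
      have "surj T" using T orthogonal_transformation_surj by blast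
      then have "T ` (T -` A) = A" by (rule surj_image_vimage_eq)
      moreover have "T ` (?B \<inter> T -` A) = ?B \<inter> T ` (T -` A)"
        using nT by (auto simp: dist_norm)
      ultimately show ?thesis by simp
    qed
    have fin: "emeasure lborel (?B \<inter> X) < \<infinity>" for X
      by (rule le_less_trans[OF emeasure_mono[of _ ?B]])
         (use ball_emeasure_nontrivial(2)[where 'a = "real ^ 'n::_"] in \<open>auto simp: top.not_eq_extremum\<close>)
    have bl: "?B \<inter> T -` A \<in> lmeasurable"
      using fin[of "T -` A"] by (intro fmeasurableI) auto
    have "measure lebesgue (?B \<inter> A) = measure lebesgue (?B \<inter> T -` A)"
      using measure_orthogonal_image[OF T bl] im by simp
    then have "emeasure lborel (?B \<inter> A) = emeasure lborel (?B \<inter> T -` A)"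
      using fin[of A] fin[of "T -` A"] by (simp add: emeasure_eq_ennreal_measure measure_completion)
    then show "emeasure (distr ?U borel T) A = emeasure ?U A"
      by (simp add: emeasure_distr emeasure_uniform_measure)
  qed simp
  moreover have "distr uniform_sphere borel T = distr (distr ?U borel T) borel (\<lambda>x. x /\<^sub>R norm x)"
    unfolding uniform_sphere_def
    by (simp add: distr_distr comp_def nT linear_cmul[OF lin])
  ultimately show ?thesis
    by (simp add: uniform_sphere_def)
qed

text \<open>Meant for nonempty compact convex \<open>\<Theta>\<close> and \<open>\<theta> \<in> \<Theta>\<close>: the faces are then again nonempty compact
  convex, so that \<open>closest_point\<close> is the Euclidean projection, and the integrand is bounded by
  the squared diameter of \<open>\<Theta>\<close>.\<close>

definition R_inf :: "'a::euclidean_space \<Rightarrow> 'a set \<Rightarrow> real" where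
  "R_inf \<theta> \<Theta> = (\<integral>u. (norm (closest_point (max_face \<Theta> u) \<theta> - \<theta>))\<^sup>2 \<partial>uniform_sphere)"

end

theory Submission
  imports Defs
begin

text \<open>For \<open>u \<noteq> 0\<close> the ellipse with half-axes \<open>a\<close>, \<open>b\<close> has a single farthest point in direction \<open>u\<close>,
  namely \<open>(a\<^sup>2 u\<^sub>1, b\<^sup>2 u\<^sub>2) / N u\<close> with \<open>N u = sqrt (a\<^sup>2 u\<^sub>1\<^sup>2 + b\<^sup>2 u\<^sub>2\<^sup>2)\<close>. When \<open>u\<close> is a unit vector, the
  squared norm of this point is \<open>a\<^sup>2 + b\<^sup>2 - (a b)\<^sup>2 / (N u)\<^sup>2\<close>, so the risk at the centre depends on the
  direction only through the mean of \<open>1 / (N U)\<^sup>2\<close>.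

  That mean is a ratio of areas. For every positive, positively homogeneous \<open>N\<close> in dimension \<open>d\<close>, polar
  coordinates show that the mean of \<open>1 / N(U)\<close> to the power \<open>d\<close> is the volume of \<open>{N \<le> 1}\<close> divided by the
  volume of the unit ball. The lemma \<open>nn_integral_ratio_of_gauges\<close> obtains this
  from Tonelli's theorem and scaling alone, without disintegrating Lebesgue measure over the sphere.
  For the \<open>N\<close> above the set is an ellipse with half-axes \<open>1 / a\<close>, \<open>1 / b\<close>, so the mean is \<open>1 / (a b)\<close> and the
  risk is \<open>a\<^sup>2 + b\<^sup>2 - a b\<close>. As a function of \<open>b\<close> this is a parabola with vertex \<open>a / 2\<close>, hence
  strictly decreasing for \<open>b < a / 2\<close>: lengthening the short axis lowers the risk.\<close>

section \<open>Integrals of homogeneous functions and the uniform law on the sphere\<close>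

lemma nn_integral_power_below_inverse:
  fixes r :: real
  assumes "r > 0" "n > 0"
  shows "(\<integral>\<^sup>+s. ennreal (real n * s ^ (n - 1)) * indicator {0<..} s * indicator {s. s * r \<le> 1} s \<partial>lborel)
    = ennreal (1 / r ^ n)"
proof -
  have "(\<integral>\<^sup>+s. ennreal (real n * s ^ (n - 1)) * indicator {0<..} s * indicator {s. s * r \<le> 1} s \<partial>lborel)
    = (\<integral>\<^sup>+s. ennreal (real n * s ^ (n - 1)) * indicator {0..1 / r} s \<partial>lborel)"
  proof (rule nn_integral_cong_AE)
    have "AE s in lborel. s \<noteq> (0::real)"
      by (rule AE_lborel_singleton)
    then show "AE s in lborel. ennreal (real n * s ^ (n - 1)) * indicator {0<..} s * indicator {s. s * r \<le> 1} s
      = ennreal (real n * s ^ (n - 1)) * indicator {0..1 / r} s"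
      by eventually_elim (use assms in \<open>auto simp: indicator_def field_simps\<close>)
  qed
  also have "\<dots> = ennreal ((1 / r) ^ n - 0 ^ n)"
    using assms by (intro nn_integral_FTC_Icc[where F = "\<lambda>s. s ^ n"])
      (auto intro!: derivative_eq_intros borel_measurable_continuous_onI continuous_intros)
  finally show ?thesis
    using assms by (simp add: power_one_over zero_power)
qed

lemma nn_integral_inverse_power_above:
  fixes r :: real
  assumes "r > 0" "n > 0"
  shows "(\<integral>\<^sup>+s. ennreal (real n / s ^ (n + 1)) * indicator {s. r < s} s \<partial>lborel) = ennreal (1 / r ^ n)"
proof -
  have "(\<integral>\<^sup>+s. ennreal (real n / s ^ (n + 1)) * indicator {s. r < s} s \<partial>lborel)
    = (\<integral>\<^sup>+s. ennreal (real n / s ^ (n + 1)) * indicator {r..} s \<partial>lborel)"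
  proof (rule nn_integral_cong_AE)
    have "AE s in lborel. s \<noteq> r"
      by (rule AE_lborel_singleton)
    then show "AE s in lborel. ennreal (real n / s ^ (n + 1)) * indicator {s. r < s} s
      = ennreal (real n / s ^ (n + 1)) * indicator {r..} s"
      by eventually_elim (auto simp: indicator_def)
  qed
  also have "\<dots> = ennreal (0 - - (inverse r ^ n))"
  proof (rule nn_integral_FTC_atLeast)
    have "((\<lambda>s::real. - (inverse s ^ n)) \<longlongrightarrow> - (0 ^ n)) at_top"
      by (intro tendsto_intros tendsto_inverse_0_at_top filterlim_ident)
    then show "((\<lambda>s::real. - (inverse s ^ n)) \<longlongrightarrow> 0) at_top"
      using assms by (simp add: zero_power)
    show "((\<lambda>s. - (inverse s ^ n)) has_real_derivative real n / s ^ (n + 1)) (at s)" if "r \<le> s" for s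
    proof -
      have s: "s \<noteq> 0"
        using assms that by simp
      then have "((\<lambda>s. - (inverse s ^ n)) has_real_derivative
          - (real n * (inverse s ^ (n - 1) * - (inverse s * 1 * inverse s)))) (at s)"
        by (auto intro!: derivative_eq_intros)
      moreover have "- (real n * (inverse s ^ (n - 1) * - (inverse s * 1 * inverse s))) = real n / s ^ (n + 1)"
        using assms by (cases n) (simp_all add: field_simps)
      ultimately show ?thesis
        by simp
    qed
  qed (use assms in auto)
  finally show ?thesis
    by (simp add: power_one_over inverse_eq_divide)
qed

lemma nn_integral_lborel_scale:
  fixes f :: "'a::euclidean_space \<Rightarrow> ennreal"
  assumes [measurable]: "f \<in> borel_measurable borel" and "c > 0"
  shows "(\<integral>\<^sup>+x. f x \<partial>lborel) = (\<integral>\<^sup>+x. ennreal (c ^ DIM('a)) * f (c *\<^sub>R x) \<partial>lborel)"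
  using assms(2)
  by (subst lborel_affine[of c 0]) (simp_all add: nn_integral_density nn_integral_distr nn_integral_cmult)

text \<open>In polar coordinates both sides are \<open>1 / DIM('a)\<close> times the integral of \<open>N powr - DIM('a)\<close> over
  the unit sphere, which is why \<open>M\<close> disappears from the right-hand side. The proof writes
  \<open>1 / N x ^ d\<close> as the integral of \<open>d s ^ (d - 1)\<close> over \<open>0 < s \<le> 1 / N x\<close> and exchanges
  the integrals. Substituting \<open>x = y / s\<close> then moves the scale from \<open>N\<close> to \<open>M\<close>: the constraints
  \<open>M x < 1\<close>, \<open>s N x \<le> 1\<close> become \<open>M y < s\<close>, \<open>N y \<le> 1\<close>, and the integral over \<open>s > M y\<close> produces
  \<open>1 / M y ^ d\<close>, which cancels the factor \<open>M y ^ d\<close>.\<close>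

lemma nn_integral_ratio_of_gauges:
  fixes M N :: "'a::euclidean_space \<Rightarrow> real"
  assumes M[measurable]: "M \<in> borel_measurable borel" and N[measurable]: "N \<in> borel_measurable borel"
    and Mscale: "\<And>c x. c > 0 \<Longrightarrow> M (c *\<^sub>R x) = c * M x"
    and Nscale: "\<And>c x. c > 0 \<Longrightarrow> N (c *\<^sub>R x) = c * N x"
    and Mpos: "\<And>x. x \<noteq> 0 \<Longrightarrow> M x > 0" and Npos: "\<And>x. x \<noteq> 0 \<Longrightarrow> N x > 0"
  shows "(\<integral>\<^sup>+x. ennreal ((M x / N x) ^ DIM('a)) * indicator {x. M x < 1} x \<partial>lborel)
    = emeasure lborel {x. N x \<le> 1}"
proof -
  let ?n = "DIM('a)"
  define G where "G s x = ennreal (real ?n * s ^ (?n - 1)) * indicator {0<..} s * indicator {s. s * N x \<le> 1} s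
      * (ennreal (M x ^ ?n) * indicator {x. M x < 1} x)" for s x
  have [measurable]: "case_prod G \<in> borel_measurable (lborel \<Otimes>\<^sub>M lborel)"
    unfolding G_def by measurable
  have n0: "?n > 0" by simp
  have AE0: "AE x in lborel. x \<noteq> (0::'a)"
    by (rule AE_lborel_singleton)
  have "(\<integral>\<^sup>+x. ennreal ((M x / N x) ^ ?n) * indicator {x. M x < 1} x \<partial>lborel)
    = (\<integral>\<^sup>+x. \<integral>\<^sup>+s. G s x \<partial>lborel \<partial>lborel)"
  proof (rule nn_integral_cong_AE, use AE0 in eventually_elim)
    fix x :: 'a assume x: "x \<noteq> 0"
    have "(\<integral>\<^sup>+s. G s x \<partial>lborel) = ennreal (1 / N x ^ ?n) * (ennreal (M x ^ ?n) * indicator {x. M x < 1} x)"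
      unfolding G_def
      by (subst nn_integral_multc) (simp_all add: nn_integral_power_below_inverse[OF Npos[OF x] n0] del: One_nat_def)
    also have "\<dots> = ennreal ((M x / N x) ^ ?n) * indicator {x. M x < 1} x"
      using Mpos[OF x] Npos[OF x]
      by (simp add: mult.assoc[symmetric] ennreal_mult[symmetric] power_divide)
    finally show "ennreal ((M x / N x) ^ ?n) * indicator {x. M x < 1} x = (\<integral>\<^sup>+s. G s x \<partial>lborel)" ..
  qed
  also have "\<dots> = (\<integral>\<^sup>+s. \<integral>\<^sup>+x. G s x \<partial>lborel \<partial>lborel)"
    by (rule lborel_pair.Fubini') measurable
  also have "\<dots> = (\<integral>\<^sup>+s. \<integral>\<^sup>+x. ennreal (real ?n / s ^ (?n + 1)) * indicator {s. M x < s} s * indicator {0<..} s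
      * (ennreal (M x ^ ?n) * indicator {x. N x \<le> 1} x) \<partial>lborel \<partial>lborel)"
  proof (rule nn_integral_cong)
    fix s :: real
    show "(\<integral>\<^sup>+x. G s x \<partial>lborel) = (\<integral>\<^sup>+x. ennreal (real ?n / s ^ (?n + 1)) * indicator {s. M x < s} s * indicator {0<..} s
      * (ennreal (M x ^ ?n) * indicator {x. N x \<le> 1} x) \<partial>lborel)"
    proof (cases "s > 0")
      case True
      have "(\<integral>\<^sup>+x. G s x \<partial>lborel) = (\<integral>\<^sup>+x. ennreal (inverse s ^ ?n) * G s (inverse s *\<^sub>R x) \<partial>lborel)"
        using True by (intro nn_integral_lborel_scale) auto
      also have "\<dots> = (\<integral>\<^sup>+x. ennreal (real ?n / s ^ (?n + 1)) * indicator {s. M x < s} s * indicator {0<..} s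
          * (ennreal (M x ^ ?n) * indicator {x. N x \<le> 1} x) \<partial>lborel)"
      proof (rule nn_integral_cong_AE, use AE0 in eventually_elim)
        fix x :: 'a assume x: "x \<noteq> 0"
        have "inverse s ^ ?n * (real ?n * s ^ (?n - 1) * (inverse s * M x) ^ ?n) = real ?n / s ^ (?n + 1) * M x ^ ?n"
        proof -
          obtain m where m: "?n = Suc m" using n0 by (cases ?n) auto
          show ?thesis using True unfolding m by (simp add: field_simps)
        qed
        then have "ennreal (inverse s ^ ?n) * (ennreal (real ?n * s ^ (?n - 1)) * ennreal ((inverse s * M x) ^ ?n))
          = ennreal (real ?n / s ^ (?n + 1)) * ennreal (M x ^ ?n)"
          using True Mpos[OF x] by (simp add: ennreal_mult[symmetric])
        then show "ennreal (inverse s ^ ?n) * G s (inverse s *\<^sub>R x)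
          = ennreal (real ?n / s ^ (?n + 1)) * indicator {s. M x < s} s * indicator {0<..} s
          * (ennreal (M x ^ ?n) * indicator {x. N x \<le> 1} x)"
          using True by (auto simp: G_def Mscale Nscale indicator_def field_simps simp del: ennreal_mult')
      qed
      finally show ?thesis .
    qed (simp add: G_def)
  qed
  also have "\<dots> = (\<integral>\<^sup>+x. \<integral>\<^sup>+s. ennreal (real ?n / s ^ (?n + 1)) * indicator {s. M x < s} s * indicator {0<..} s
      * (ennreal (M x ^ ?n) * indicator {x. N x \<le> 1} x) \<partial>lborel \<partial>lborel)"
    by (rule lborel_pair.Fubini'[symmetric]) measurable
  also have "\<dots> = (\<integral>\<^sup>+x. indicator {x. N x \<le> 1} x \<partial>lborel)"
  proof (rule nn_integral_cong_AE, use AE0 in eventually_elim)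
    fix x :: 'a assume x: "x \<noteq> 0"
    have "(\<integral>\<^sup>+s. ennreal (real ?n / s ^ (?n + 1)) * indicator {s. M x < s} s * indicator {0<..} s
      * (ennreal (M x ^ ?n) * indicator {x. N x \<le> 1} x) \<partial>lborel)
      = ennreal (1 / M x ^ ?n) * (ennreal (M x ^ ?n) * indicator {x. N x \<le> 1} x)"
    proof -
      have "(\<integral>\<^sup>+s. ennreal (real ?n / s ^ (?n + 1)) * indicator {s. M x < s} s * indicator {0<..} s
        * (ennreal (M x ^ ?n) * indicator {x. N x \<le> 1} x) \<partial>lborel)
        = (\<integral>\<^sup>+s. ennreal (real ?n / s ^ (?n + 1)) * indicator {s. M x < s} s
        * (ennreal (M x ^ ?n) * indicator {x. N x \<le> 1} x) \<partial>lborel)"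
        using Mpos[OF x] by (intro nn_integral_cong) (auto simp: indicator_def)
      also have "\<dots> = (\<integral>\<^sup>+s. ennreal (real ?n / s ^ (?n + 1)) * indicator {s. M x < s} s \<partial>lborel)
        * (ennreal (M x ^ ?n) * indicator {x. N x \<le> 1} x)"
        by (rule nn_integral_multc) measurable
      finally show ?thesis
        by (simp only: nn_integral_inverse_power_above[OF Mpos[OF x] n0])
    qed
    also have "\<dots> = indicator {x. N x \<le> 1} x"
      using Mpos[OF x] by (simp add: mult.assoc[symmetric] ennreal_mult[symmetric])
    finally show "(\<integral>\<^sup>+s. ennreal (real ?n / s ^ (?n + 1)) * indicator {s. M x < s} s * indicator {0<..} s
      * (ennreal (M x ^ ?n) * indicator {x. N x \<le> 1} x) \<partial>lborel) = indicator {x. N x \<le> 1} x" .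
  qed
  also have "\<dots> = emeasure lborel {x. N x \<le> 1}"
    by (rule nn_integral_indicator) measurable
  finally show ?thesis .
qed

text \<open>By homogeneity, \<open>1 / N\<close> at the normalised point \<open>x /\<^sub>R norm x\<close> is \<open>norm x / N x\<close>, so this is the previous
  identity with \<open>M = norm\<close>.\<close>

lemma nn_integral_uniform_sphere_inverse_gauge:
  fixes N :: "'a::euclidean_space \<Rightarrow> real"
  assumes N[measurable]: "N \<in> borel_measurable borel"
    and Nscale: "\<And>c x. c > 0 \<Longrightarrow> N (c *\<^sub>R x) = c * N x"
    and Npos: "\<And>x. x \<noteq> 0 \<Longrightarrow> N x > 0"
  shows "(\<integral>\<^sup>+u. ennreal (1 / N u ^ DIM('a)) \<partial>uniform_sphere)
    = emeasure lborel {x. N x \<le> 1} / emeasure lborel (ball (0::'a) 1)"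
proof -
  let ?n = "DIM('a)"
  have "(\<integral>\<^sup>+u. ennreal (1 / N u ^ ?n) \<partial>uniform_sphere)
    = (\<integral>\<^sup>+x. ennreal (1 / N (x /\<^sub>R norm x) ^ ?n) * indicator (ball 0 1) x \<partial>lborel)
        / emeasure lborel (ball (0::'a) 1)"
    unfolding uniform_sphere_def
    using ball_emeasure_nontrivial[where 'a = 'a]
    by (subst nn_integral_distr) (simp_all add: nn_integral_uniform_measure)
  also have "(\<integral>\<^sup>+x. ennreal (1 / N (x /\<^sub>R norm x) ^ ?n) * indicator (ball 0 1) x \<partial>lborel)
    = (\<integral>\<^sup>+x. ennreal ((norm x / N x) ^ ?n) * indicator {x::'a. norm x < 1} x \<partial>lborel)"
  proof (rule nn_integral_cong_AE)
    have "AE x in lborel. x \<noteq> (0::'a)"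
      by (rule AE_lborel_singleton)
    then show "AE x in lborel. ennreal (1 / N (x /\<^sub>R norm x) ^ ?n) * indicator (ball 0 1) x
      = ennreal ((norm x / N x) ^ ?n) * indicator {x::'a. norm x < 1} x"
      by eventually_elim (auto simp: Nscale indicator_def power_divide field_simps)
  qed
  also have "\<dots> = emeasure lborel {x. N x \<le> 1}"
    using assms by (intro nn_integral_ratio_of_gauges) auto
  finally show ?thesis .
qed

section \<open>Faces and risk of an ellipse\<close>

text \<open>This is the support function of \<open>ellipse a b\<close>; its sublevel set at \<open>1\<close> is the polar
  ellipse, with half-axes \<open>1 / a\<close> and \<open>1 / b\<close>.\<close>

definition axis_gauge :: "real \<Rightarrow> real \<Rightarrow> real ^ 2 \<Rightarrow> real" where
  "axis_gauge a b u = sqrt (a\<^sup>2 * (u $ 1)\<^sup>2 + b\<^sup>2 * (u $ 2)\<^sup>2)"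

lemma axis_gauge_pos:
  assumes "a > 0" "b > 0" "u \<noteq> 0"
  shows "axis_gauge a b u > 0"
proof -
  have "u $ 1 \<noteq> 0 \<or> u $ 2 \<noteq> 0"
    using assms(3) by (auto simp: vec_eq_iff forall_2)
  then show ?thesis
    using assms by (auto simp: axis_gauge_def intro: add_pos_nonneg add_nonneg_pos)
qed

lemma axis_gauge_power2: "(axis_gauge a b u)\<^sup>2 = a\<^sup>2 * (u $ 1)\<^sup>2 + b\<^sup>2 * (u $ 2)\<^sup>2"
  by (simp add: axis_gauge_def)

lemma borel_measurable_axis_gauge[measurable]: "axis_gauge a b \<in> borel_measurable borel"
  unfolding axis_gauge_def by (intro borel_measurable_continuous_onI continuous_intros)

lemma emeasure_axis_gauge_le_1:
  assumes "a > 0" "b > 0"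
  shows "emeasure lborel {x. axis_gauge a b x \<le> 1} = ennreal (1 / (a * b)) * emeasure lborel (ball (0 :: real ^ 2) 1)"
proof -
  define m :: "2 \<Rightarrow> real" where "m k = (if k = 1 then 1 / a else 1 / b)" for k
  have image: "{x. axis_gauge a b x \<le> 1} = (\<lambda>x. \<chi> k. m k * x $ k) ` cball 0 1"
  proof (rule set_eqI, rule iffI)
    fix x :: "real ^ 2" assume "x \<in> {x. axis_gauge a b x \<le> 1}"
    then have "(\<chi> k. x $ k / m k) \<in> cball (0 :: real ^ 2) 1"
      by (simp add: axis_gauge_def norm_vec_def L2_set_def sum_2 m_def power_mult_distrib mult.commute)
    moreover have "x = (\<chi> k. m k * (\<chi> k. x $ k / m k) $ k)"
      using assms by (simp add: vec_eq_iff m_def)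
    ultimately show "x \<in> (\<lambda>x. \<chi> k. m k * x $ k) ` cball 0 1"
      by blast
  next
    fix x :: "real ^ 2" assume "x \<in> (\<lambda>x. \<chi> k. m k * x $ k) ` cball 0 1"
    then show "x \<in> {x. axis_gauge a b x \<le> 1}"
      using assms
      by (auto simp: axis_gauge_def norm_vec_def L2_set_def sum_2 m_def power_divide)
  qed
  have "prod m UNIV = 1 / (a * b)"
    by (simp add: UNIV_2 m_def)
  then have "measure lebesgue {x. axis_gauge a b x \<le> 1} = 1 / (a * b) * measure lebesgue (cball (0 :: real ^ 2) 1)"
    unfolding image using assms by (simp add: measure_stretch)
  moreover have "emeasure lborel {x. axis_gauge a b x \<le> 1} = ennreal (measure lebesgue {x. axis_gauge a b x \<le> 1})"
  proof -
    have "{x. axis_gauge a b x \<le> 1} \<in> lmeasurable"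
      unfolding image by (intro measurable_stretch) simp
    then have "emeasure lebesgue {x. axis_gauge a b x \<le> 1} = ennreal (measure lebesgue {x. axis_gauge a b x \<le> 1})"
      by (simp add: emeasure_eq_measure2)
    moreover have "{x. axis_gauge a b x \<le> 1} \<in> sets borel"
      by measurable
    ultimately show ?thesis by simp
  qed
  moreover have "emeasure lborel (ball (0 :: real ^ 2) 1) = ennreal (measure lebesgue (cball (0 :: real ^ 2) 1))"
    by (simp add: emeasure_ball content_cball)
  ultimately show ?thesis
    using assms by (simp add: ennreal_mult[symmetric])
qed

text \<open>The equality case of the Cauchy--Schwarz inequality for \<open>(y\<^sub>1 / a, y\<^sub>2 / b)\<close> and \<open>(a u\<^sub>1, b u\<^sub>2)\<close>:
  the squared distance between the first vector and the normalised second one is at most a constant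
  times the gap between \<open>y \<bullet> u\<close> and its maximum, so a maximiser \<open>y\<close> must be the displayed point.\<close>

lemma max_face_ellipse:
  assumes a: "a > 0" and b: "b > 0" and u: "u \<noteq> 0"
  shows "max_face (ellipse a b) u
    = {vector [a\<^sup>2 * u $ 1 / axis_gauge a b u, b\<^sup>2 * u $ 2 / axis_gauge a b u]}"
proof -
  let ?r = "axis_gauge a b u"
  let ?p = "vector [a\<^sup>2 * u $ 1 / ?r, b\<^sup>2 * u $ 2 / ?r] :: real ^ 2"
  have r: "?r > 0" using assms by (rule axis_gauge_pos)
  have r2: "?r\<^sup>2 = a\<^sup>2 * (u $ 1)\<^sup>2 + b\<^sup>2 * (u $ 2)\<^sup>2" by (rule axis_gauge_power2)
  have inner: "y \<bullet> u = y $ 1 * u $ 1 + y $ 2 * u $ 2" for y :: "real ^ 2"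
    by (simp add: inner_vec_def sum_2)
  have p: "?p \<in> ellipse a b" "?p \<bullet> u = ?r"
  proof -
    have "(a\<^sup>2 * u $ 1 / ?r)\<^sup>2 / a\<^sup>2 + (b\<^sup>2 * u $ 2 / ?r)\<^sup>2 / b\<^sup>2 = (a\<^sup>2 * (u $ 1)\<^sup>2 + b\<^sup>2 * (u $ 2)\<^sup>2) / ?r\<^sup>2"
      using a b r by (simp add: field_simps power2_eq_square)
    also have "\<dots> = 1" using r by (simp add: r2[symmetric])
    finally show "?p \<in> ellipse a b" by (simp add: ellipse_def)
    have "?p \<bullet> u = (a\<^sup>2 * (u $ 1)\<^sup>2 + b\<^sup>2 * (u $ 2)\<^sup>2) / ?r"
      by (simp add: inner power2_eq_square add_divide_distrib)
    also have "\<dots> = ?r" unfolding r2[symmetric] using r by (simp add: power2_eq_square)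
    finally show "?p \<bullet> u = ?r" .
  qed
  have defect: "(y $ 1 / a - a * u $ 1 / ?r)\<^sup>2 + (y $ 2 / b - b * u $ 2 / ?r)\<^sup>2 \<le> 2 - 2 * (y \<bullet> u) / ?r"
    if "y \<in> ellipse a b" for y
  proof -
    have "(y $ 1 / a - a * u $ 1 / ?r)\<^sup>2 + (y $ 2 / b - b * u $ 2 / ?r)\<^sup>2
      = ((y $ 1)\<^sup>2 / a\<^sup>2 + (y $ 2)\<^sup>2 / b\<^sup>2) - 2 * (y \<bullet> u) / ?r + (a\<^sup>2 * (u $ 1)\<^sup>2 + b\<^sup>2 * (u $ 2)\<^sup>2) / ?r\<^sup>2"
      using a b r by (simp add: inner field_simps power2_eq_square)
    also have "(a\<^sup>2 * (u $ 1)\<^sup>2 + b\<^sup>2 * (u $ 2)\<^sup>2) / ?r\<^sup>2 = 1" using r by (simp add: r2[symmetric])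
    finally show ?thesis using that by (simp add: ellipse_def)
  qed
  have le: "y \<bullet> u \<le> ?r" if "y \<in> ellipse a b" for y
  proof -
    have "0 \<le> 2 - 2 * (y \<bullet> u) / ?r"
      using defect[OF that] by (smt (verit) zero_le_power2)
    then show ?thesis using r by (simp add: field_simps)
  qed
  have eq: "y = ?p" if "y \<in> ellipse a b" "y \<bullet> u = ?r" for y
  proof -
    have "(y $ 1 / a - a * u $ 1 / ?r)\<^sup>2 + (y $ 2 / b - b * u $ 2 / ?r)\<^sup>2 \<le> 0"
      using defect[OF that(1)] that(2) r by simp
    then have "y $ 1 / a - a * u $ 1 / ?r = 0 \<and> y $ 2 / b - b * u $ 2 / ?r = 0"
      by (simp add: sum_power2_le_zero_iff)
    then have "y $ 1 = a * (a * u $ 1 / ?r)" "y $ 2 = b * (b * u $ 2 / ?r)"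
      using a b by (auto simp: divide_eq_eq mult.commute)
    then show ?thesis
      by (simp add: vec_eq_iff forall_2 power2_eq_square)
  qed
  show ?thesis
  proof (intro equalityI subsetI)
    fix y assume "y \<in> max_face (ellipse a b) u"
    then have y: "y \<in> ellipse a b" "?p \<bullet> u \<le> y \<bullet> u"
      using p(1) by (auto simp: max_face_def is_arg_max_linorder)
    then have "y \<bullet> u = ?r"
      using le[OF y(1)] p(2) by linarith
    then show "y \<in> {?p}"
      using eq[OF y(1)] by blast
  next
    fix y assume "y \<in> {?p}"
    then have "y \<in> ellipse a b" "y \<bullet> u = ?r"
      using p by auto
    then show "y \<in> max_face (ellipse a b) u"
      using le by (simp add: max_face_def is_arg_max_linorder)
  qed
qed

lemma closest_point_singleton: "closest_point {p} x = p"
  using closest_point_in_set[of "{p}" x] by simp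

text \<open>This rests on the identity \<open>a\<^sup>4 u\<^sub>1\<^sup>2 + b\<^sup>4 u\<^sub>2\<^sup>2 = (a\<^sup>2 + b\<^sup>2) (a\<^sup>2 u\<^sub>1\<^sup>2 + b\<^sup>2 u\<^sub>2\<^sup>2) - a\<^sup>2 b\<^sup>2 (u\<^sub>1\<^sup>2 + u\<^sub>2\<^sup>2)\<close>,
  which leaves the reciprocal of the gauge as the only term depending on a unit direction.\<close>

lemma norm_squared_projection_max_face_ellipse:
  assumes "a > 0" "b > 0" "u \<noteq> 0"
  shows "(norm (closest_point (max_face (ellipse a b) u) 0))\<^sup>2 = a\<^sup>2 + b\<^sup>2 - (a * b)\<^sup>2 * (norm u)\<^sup>2 / (axis_gauge a b u)\<^sup>2"
proof -
  let ?r = "axis_gauge a b u"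
  have r: "?r > 0" using assms by (rule axis_gauge_pos)
  have norm2: "(norm y)\<^sup>2 = (y $ 1)\<^sup>2 + (y $ 2)\<^sup>2" for y :: "real ^ 2"
    by (simp add: norm_vec_def L2_set_def sum_2)
  have "(norm (closest_point (max_face (ellipse a b) u) 0))\<^sup>2 * ?r\<^sup>2 = (a\<^sup>2 * u $ 1)\<^sup>2 + (b\<^sup>2 * u $ 2)\<^sup>2"
    unfolding max_face_ellipse[OF assms] closest_point_singleton norm2
    using r by (simp add: power_divide distrib_right)
  also have "\<dots> = (a\<^sup>2 + b\<^sup>2) * ?r\<^sup>2 - (a * b)\<^sup>2 * (norm u)\<^sup>2"
    unfolding axis_gauge_power2 norm2 by algebra
  finally show ?thesis
    using r by (simp add: field_simps)
qed

lemma R_inf_ellipse: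
  assumes a: "a > 0" and b: "b > 0"
  shows "R_inf 0 (ellipse a b) = a\<^sup>2 + b\<^sup>2 - a * b"
proof -
  interpret prob_space "uniform_sphere :: (real ^ 2) measure" by (rule prob_space_uniform_sphere)
  let ?f = "\<lambda>u. (norm (closest_point (max_face (ellipse a b) u) 0))\<^sup>2"
  have sets[measurable_cong, simp]: "sets (uniform_sphere :: (real ^ 2) measure) = sets borel"
    by (simp add: uniform_sphere_def)
  have nn: "(\<integral>\<^sup>+u. ennreal (1 / (axis_gauge a b u)\<^sup>2) \<partial>uniform_sphere) = ennreal (1 / (a * b))"
  proof -
    have scale: "axis_gauge a b (c *\<^sub>R x) = c * axis_gauge a b x" if "c > 0" for c x
    proof (rule power2_eq_imp_eq)
      show "(axis_gauge a b (c *\<^sub>R x))\<^sup>2 = (c * axis_gauge a b x)\<^sup>2"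
        by (simp add: axis_gauge_power2 power_mult_distrib algebra_simps)
    qed (use that in \<open>auto simp: axis_gauge_def\<close>)
    have "(\<integral>\<^sup>+u. ennreal (1 / (axis_gauge a b u) ^ DIM(real ^ 2)) \<partial>uniform_sphere)
      = ennreal (1 / (a * b)) * emeasure lborel (ball (0 :: real ^ 2) 1) / emeasure lborel (ball (0 :: real ^ 2) 1)"
      unfolding emeasure_axis_gauge_le_1[OF a b, symmetric]
      using axis_gauge_pos[OF a b] scale
      by (intro nn_integral_uniform_sphere_inverse_gauge) auto
    then show ?thesis
      using ball_emeasure_nontrivial[where 'a = "real ^ 2"]
      by (simp add: ennreal_mult_divide_eq)
  qed
  have int: "integrable uniform_sphere (\<lambda>u. 1 / (axis_gauge a b u)\<^sup>2)"
    using nn by (intro integrableI_nonneg) auto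
  have val: "(\<integral>u. 1 / (axis_gauge a b u)\<^sup>2 \<partial>uniform_sphere) = 1 / (a * b)"
    using nn a b by (subst integral_eq_nn_integral) auto
  have "R_inf 0 (ellipse a b) = (\<integral>u. a\<^sup>2 + b\<^sup>2 - (a * b)\<^sup>2 * (1 / (axis_gauge a b u)\<^sup>2) \<partial>uniform_sphere)"
    unfolding R_inf_def diff_zero
  proof (rule integral_cong_AE)
    \<comment> \<open>Measurability has to hold everywhere, also at the origin, where the face is the whole ellipse.\<close>
    have "?f = (\<lambda>u. if u = 0 then ?f 0 else a\<^sup>2 + b\<^sup>2 - (a * b)\<^sup>2 * (norm u)\<^sup>2 / (axis_gauge a b u)\<^sup>2)"
      using norm_squared_projection_max_face_ellipse[OF a b] by auto
    also have "\<dots> \<in> borel_measurable uniform_sphere"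
      by measurable
    finally show "?f \<in> borel_measurable uniform_sphere" .
    show "(\<lambda>u. a\<^sup>2 + b\<^sup>2 - (a * b)\<^sup>2 * (1 / (axis_gauge a b u)\<^sup>2)) \<in> borel_measurable uniform_sphere"
      by measurable
    show "AE u in uniform_sphere. ?f u = a\<^sup>2 + b\<^sup>2 - (a * b)\<^sup>2 * (1 / (axis_gauge a b u)\<^sup>2)"
      using AE_uniform_sphere
    proof eventually_elim
      case (elim u)
      then have "u \<noteq> 0" "norm u = 1" by auto
      then show ?case
        by (simp add: norm_squared_projection_max_face_ellipse[OF a b])
    qed
  qed
  also have "\<dots> = a\<^sup>2 + b\<^sup>2 - (a * b)\<^sup>2 * (1 / (a * b))"
    using int by (subst Bochner_Integration.integral_diff)
      (simp_all only: integrable_const integrable_mult_right integral_mult_right_zero val lebesgue_integral_const prob_space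
        scaleR_one)
  also have "\<dots> = a\<^sup>2 + b\<^sup>2 - a * b"
    using a b by (simp add: power2_eq_square)
  finally show ?thesis .
qed

lemma ellipse_strict_mono:
  assumes "0 < b" "b < b'"
  shows "ellipse a b \<subset> ellipse a b'"
proof
  show "ellipse a b \<subseteq> ellipse a b'"
  proof
    fix y assume "y \<in> ellipse a b"
    moreover have "(y $ 2)\<^sup>2 / b'\<^sup>2 \<le> (y $ 2)\<^sup>2 / b\<^sup>2"
      using assms by (intro divide_left_mono power_mono) auto
    ultimately show "y \<in> ellipse a b'"
      by (simp add: ellipse_def)
  qed
  have "(vector [0, b'] :: real ^ 2) \<in> ellipse a b'" 
    using assms by (simp add: ellipse_def)
  moreover have "(vector [0, b'] :: real ^ 2) \<notin> ellipse a b" 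
    using assms by (simp add: ellipse_def field_simps)
  ultimately show "ellipse a b \<noteq> ellipse a b'" by blast
qed

theorem corollary2p5:
  fixes a b\<^sub>S b\<^sub>L :: real
  assumes "a > 0" and "0 < b\<^sub>S" and "b\<^sub>S < b\<^sub>L" and "b\<^sub>L < a / 2"
  shows "ellipse a b\<^sub>S \<subset> ellipse a b\<^sub>L
    \<and> R_inf 0 (ellipse a b\<^sub>S) > R_inf 0 (ellipse a b\<^sub>L)"
proof
  show "ellipse a b\<^sub>S \<subset> ellipse a b\<^sub>L"
    using assms by (intro ellipse_strict_mono)
  \<comment> \<open>The product is the difference of the two risks.\<close>
  have "(b\<^sub>L - b\<^sub>S) * (a - b\<^sub>L - b\<^sub>S) > 0"
    using assms by (intro mult_pos_pos) auto
  then show "R_inf 0 (ellipse a b\<^sub>S) > R_inf 0 (ellipse a b\<^sub>L)"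
    using assms by (simp add: R_inf_ellipse algebra_simps power2_eq_square)
qed

end
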